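(* Suppose that for all $i\in\mathcal V$ $$4(X_{di}'-X_{di}'')T_{di}'-(X_{di}-X_{di}')T_{di}''>0,\qquad 4(X_{qi}'-X_{qi}'')T_{qi}'-(X_{qi}-X_{qi}')T_{qi}''>0 .$$ Then the system $$\dot x_p=F\,\nabla H_p(x_p)+g(P_m-P_d),\qquad y=g^T\nabla H_p(x_p),$$ with state $x_p=(p,\eta,E_q',E_d',E_q'',E_d'')$, Hamiltonian $H_p$ and constant matrices $F$, $g$ as defined in the context, is a port-Hamiltonian representation of the sixth-order multi-machine network model given in the context. That is, the multi-machine model takes this form in the variables $p_i=M_i\omega_i$, $\eta=D^T\delta$, $E_q',E_d',E_q'',E_d''$, and $F=J-R$ with $J=-J^T$ and $R=R^T\ge 0$.
   Context: **Network.** $\mathcal G=(\mathcal V,\mathcal E)$ is a connected undirected graph with $\mathcal V=\{1,\dots,n\}$ and $m$ edges. The ends of each edge are arbitrarily labeled $+$ and $-$, and $D\in\mathbb R^{n\times m}$ is the incidence matrix ($D_{il}=+1$ if $i$ is the positive end of $l$, $-1$ if $i$ is the negative end of $l$, $0$ otherwise). $\mathcal N_i$ is the set of neighbors of $i$. For each edge between $i$ and $k$ there is a line susceptance $B_{ik}=B_{ki}<0$, and $B_{ii}=\sum_{k\in\mathcal N_i}B_{ik}$. **Parameters.** For every $i\in\mathcal V$: $M_i>0$; time constants $T_{di}',T_{qi}',T_{di}'',T_{qi}''>0$; reactances with $X_{di}>X_{di}'>X_{di}''>0$, $X_{qi}>X_{qi}'>X_{qi}''>0$ and $X_{di}''=X_{qi}''$;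 the excitation voltage $E_{fi}\in\mathbb R$ is constant. $P_m=(P_{mi})\in\mathbb R^n$ is the mechanical power injection (input) and $P_d=(P_{di})\in\mathbb R^n$ is the constant power demand. **Multi-machine model.** With $\delta_{ik}:=\delta_i-\delta_k$, for all $i\in\mathcal V$: $$\begin{aligned} M_i\dot\omega_i&=P_{mi}-P_{di}+\sum_{k\in\mathcal N_i}B_{ik}\big[(E_{di}''E_{dk}''+E_{qi}''E_{qk}'')\sin\delta_{ik}+(E_{di}''E_{qk}''-E_{qi}''E_{dk}'')\cos\delta_{ik}\big]\\ \dot\delta_i&=\omega_i\\ T_{di}'\dot E_{qi}'&=E_{fi}-E_{qi}'+(X_{di}-X_{di}')\Big(B_{ii}E_{qi}''-\sum_{k\in\mathcal N_i}B_{ik}(E_{dk}''\sin\delta_{ik}+E_{qk}''\cos\delta_{ik})\Big)\\ T_{qi}'\dot E_{di}'&=-E_{di}'+(X_{qi}-X_{qi}')\Big(B_{ii}E_{di}''-\sum_{k\in\mathcal N_i}B_{ik}(E_{dk}''\cos\delta_{ik}-E_{qk}''\sin\delta_{ik})\Big)\\ T_{di}''\dot E_{qi}''&=E_{qi}'-E_{qi}''+(X_{di}'-X_{di}'')\Big(B_{ii}E_{qi}''-\sum_{k\in\mathcal N_i}B_{ik}(E_{dk}''\sin\delta_{ik}+E_{qk}''\cos\delta_{ik})\Big)\\ T_{qi}''\dot E_{di}''&=E_{di}'-E_{di}''+(X_{qi}'-X_{qi}'')\Big(B_{ii}E_{di}''-\sum_{k\in\mathcal N_i}B_{ik}(E_{dk}''\cos\delta_{ik}-E_{qk}''\sin\delta_{ik})\Big)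 \end{aligned}$$ **State variables.** $p_i=M_i\omega_i$; $\eta=D^T\delta\in\mathbb R^m$, i.e. $\eta_l=\delta_i-\delta_k$ where $i,k$ are the positive and negative ends of $l$; $E_q',E_d',E_q'',E_d''\in\mathbb R^n$ are the stacked voltages. **Hamiltonian.** $H_p=\sum_{i\in\mathcal V}(H_{edi}+H_{eqi}+H_{mi})+\sum_{l\in\mathcal E}H_l$, where $$H_{edi}=\tfrac12\Big(\tfrac{(E_{qi}'-E_{fi})^2}{X_{di}-X_{di}'}+\tfrac{(E_{qi}'-E_{qi}'')^2}{X_{di}'-X_{di}''}\Big),\quad H_{eqi}=\tfrac12\Big(\tfrac{(E_{di}')^2}{X_{qi}-X_{qi}'}+\tfrac{(E_{di}'-E_{di}'')^2}{X_{qi}'-X_{qi}''}\Big),\quad H_{mi}=\tfrac12M_i^{-1}p_i^2,$$ and for the edge $l$ with positive end $i$ and negative end $k$, $$H_l=-\tfrac12B_{ik}\Big(2(E_{di}''E_{qk}''-E_{dk}''E_{qi}'')\sin\eta_l-2(E_{di}''E_{dk}''+E_{qi}''E_{qk}'')\cos\eta_l+E_{di}''^2+E_{dk}''^2+E_{qi}''^2+E_{qk}''^2\Big).$$ **Matrices.** $\hat X_d=\mathrm{diag}(X_{di}-X_{di}')$, $\hat X_d'=\mathrm{diag}(X_{di}'-X_{di}'')$, $\hat X_q=\mathrm{diag}(X_{qi}-X_{qi}')$, $\hat X_q'=\mathrm{diag}(X_{qi}'-X_{qi}'')$, $T_d'=\mathrm{diag}(T_{di}')$, and similarly $T_q',T_d'',T_q''$.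 In block form corresponding to $(p,\eta,E_q',E_d',E_q'',E_d'')$, $$F=\begin{bmatrix}0&-D&0&0&0&0\\ D^T&0&0&0&0&0\\ 0&0&-(T_d')^{-1}\hat X_d&0&-(T_d')^{-1}\hat X_d&0\\ 0&0&0&-(T_q')^{-1}\hat X_q&0&-(T_q')^{-1}\hat X_q\\ 0&0&0&0&-(T_d'')^{-1}\hat X_d'&0\\ 0&0&0&0&0&-(T_q'')^{-1}\hat X_q'\end{bmatrix},\qquad g=\begin{bmatrix}I&0&0&0&0&0\end{bmatrix}^T .$$ $J=\tfrac12(F-F^T)$ and $R=-\tfrac12(F+F^T)$, so $F=J-R$. A system $\dot x=(J-R)\nabla H(x)+gu$, $y=g^T\nabla H(x)$ is port-Hamiltonian if $J=-J^T$ and $R=R^T\ge0$. *)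

theory Defs
  imports "HOL-Analysis.Analysis"
begin

section \<open>Port-Hamiltonian systems\<close>

text \<open>
  The description operator is meaningful only where the function is differentiable;
  differentiability is therefore part of the predicate \<open>port_hamiltonian\<close> below.
\<close>

definition gradient :: "('a::euclidean_space \<Rightarrow> real) \<Rightarrow> 'a \<Rightarrow> 'a" where
  "gradient H x = (THE v. GDERIV H x :> v)"

definition port_hamiltonian ::
  "real^'s^'s \<Rightarrow> real^'s^'s \<Rightarrow> (real^('s::finite) \<Rightarrow> real) \<Rightarrow> bool" where
  "port_hamiltonian J R H \<longleftrightarrow>
     (\<forall>x. H differentiable (at x)) \<and>
     J = - transpose J \<and>
     R = transpose R \<and> (\<forall>x. 0 \<le> x \<bullet> (R *v x))"

text \<open>
  \<open>x\<close> is, on the time set \<open>I\<close>, a trajectory of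
  $\dot x = F\,\nabla H(x) + g\,u$, $y = g^T \nabla H(x)$ with input \<open>u\<close> and output \<open>y\<close>.
\<close>

definition system_trajectory ::
  "real^'s^'s \<Rightarrow> (real^'s \<Rightarrow> real) \<Rightarrow> real^'k^'s \<Rightarrow> real set \<Rightarrow>
   (real \<Rightarrow> real^'k) \<Rightarrow> (real \<Rightarrow> real^('s::finite)) \<Rightarrow> (real \<Rightarrow> real^('k::finite)) \<Rightarrow> bool" where
  "system_trajectory F H g I u x y \<longleftrightarrow>
     (\<forall>t\<in>I.
        (x has_vector_derivative (F *v gradient H (x t) + g *v u t)) (at t within I) \<and>
        y t = transpose g *v gradient H (x t))"


section \<open>Networks of synchronous machines\<close>

text \<open>
  \<open>'n\<close> is the vertex type and \<open>'m\<close> the edge type, so that $n$ and $m$ are the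
  cardinalities of \<open>'n\<close> and \<open>'m\<close>.
\<close>

record ('n, 'm) network =
  pos_end :: "'m \<Rightarrow> 'n"
  neg_end :: "'m \<Rightarrow> 'n"
  suscept :: "'n \<Rightarrow> 'n \<Rightarrow> real"
  inertia :: "'n \<Rightarrow> real"
  T_d' :: "'n \<Rightarrow> real"
  T_q' :: "'n \<Rightarrow> real"
  T_d'' :: "'n \<Rightarrow> real"
  T_q'' :: "'n \<Rightarrow> real"
  X_d :: "'n \<Rightarrow> real"
  X_d' :: "'n \<Rightarrow> real"
  X_d'' :: "'n \<Rightarrow> real"
  X_q :: "'n \<Rightarrow> real"
  X_q' :: "'n \<Rightarrow> real"
  X_q'' :: "'n \<Rightarrow> real"
  E_f :: "'n \<Rightarrow> real"
  P_d :: "real^'n"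

definition adjacent :: "('n::finite, 'm::finite) network \<Rightarrow> 'n \<Rightarrow> 'n \<Rightarrow> bool" where
  "adjacent N i k \<longleftrightarrow> (\<exists>l. {pos_end N l, neg_end N l} = {i, k})"

definition neighbors :: "('n::finite, 'm::finite) network \<Rightarrow> 'n \<Rightarrow> 'n set" where
  "neighbors N i = {k. adjacent N i k}"

text \<open>
  The first three conditions say that the graph has no loops, has no parallel edges
  (in either orientation) and is connected.
\<close>

definition machine_network :: "('n::finite, 'm::finite) network \<Rightarrow> bool" where
  "machine_network N \<longleftrightarrow>
     (\<forall>l. pos_end N l \<noteq> neg_end N l) \<and>
     inj (\<lambda>l. {pos_end N l, neg_end N l}) \<and>
     (\<forall>i k. (i, k) \<in> {(a, b). adjacent N a b}\<^sup>*) \<and>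
     (\<forall>i k. adjacent N i k \<longrightarrow> suscept N i k = suscept N k i \<and> suscept N i k < 0) \<and>
     (\<forall>i. suscept N i i = (\<Sum>k\<in>neighbors N i. suscept N i k)) \<and>
     (\<forall>i. inertia N i > 0) \<and>
     (\<forall>i. T_d' N i > 0 \<and> T_q' N i > 0 \<and> T_d'' N i > 0 \<and> T_q'' N i > 0) \<and>
     (\<forall>i. X_d N i > X_d' N i \<and> X_d' N i > X_d'' N i \<and> X_d'' N i > 0) \<and>
     (\<forall>i. X_q N i > X_q' N i \<and> X_q' N i > X_q'' N i \<and> X_q'' N i > 0) \<and>
     (\<forall>i. X_d'' N i = X_q'' N i)"

definition D_mat :: "('n::finite, 'm::finite) network \<Rightarrow> real^'m^'n" where
  "D_mat N = (\<chi> i l. if i = pos_end N l then 1 else if i = neg_end N l then - 1 else 0)"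


section \<open>The multi-machine model\<close>

text \<open>
  The algebraic relation between the instantaneous values of the variables and their
  time derivatives (prefix \<open>d\<close>).
\<close>

definition multi_machine_equations ::
  "('n::finite, 'm::finite) network \<Rightarrow> real^'n \<Rightarrow>
   real^'n \<Rightarrow> real^'n \<Rightarrow> real^'n \<Rightarrow> real^'n \<Rightarrow> real^'n \<Rightarrow> real^'n \<Rightarrow>
   real^'n \<Rightarrow> real^'n \<Rightarrow> real^'n \<Rightarrow> real^'n \<Rightarrow> real^'n \<Rightarrow> real^'n \<Rightarrow> bool" where
  "multi_machine_equations N Pm \<omega> \<delta> Eq' Ed' Eq'' Ed'' d\<omega> d\<delta> dEq' dEd' dEq'' dEd'' \<longleftrightarrow>
     (\<forall>i.
        inertia N i * d\<omega> $ i = Pm $ i - P_d N $ i +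
          (\<Sum>k\<in>neighbors N i. suscept N i k *
             ((Ed'' $ i * Ed'' $ k + Eq'' $ i * Eq'' $ k) * sin (\<delta> $ i - \<delta> $ k) +
              (Ed'' $ i * Eq'' $ k - Eq'' $ i * Ed'' $ k) * cos (\<delta> $ i - \<delta> $ k))) \<and>
        d\<delta> $ i = \<omega> $ i \<and>
        T_d' N i * dEq' $ i = E_f N i - Eq' $ i + (X_d N i - X_d' N i) *
          (suscept N i i * Eq'' $ i -
           (\<Sum>k\<in>neighbors N i. suscept N i k *
              (Ed'' $ k * sin (\<delta> $ i - \<delta> $ k) + Eq'' $ k * cos (\<delta> $ i - \<delta> $ k)))) \<and>
        T_q' N i * dEd' $ i = - Ed' $ i + (X_q N i - X_q' N i) *
          (suscept N i i * Ed'' $ i -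
           (\<Sum>k\<in>neighbors N i. suscept N i k *
              (Ed'' $ k * cos (\<delta> $ i - \<delta> $ k) - Eq'' $ k * sin (\<delta> $ i - \<delta> $ k)))) \<and>
        T_d'' N i * dEq'' $ i = Eq' $ i - Eq'' $ i + (X_d' N i - X_d'' N i) *
          (suscept N i i * Eq'' $ i -
           (\<Sum>k\<in>neighbors N i. suscept N i k *
              (Ed'' $ k * sin (\<delta> $ i - \<delta> $ k) + Eq'' $ k * cos (\<delta> $ i - \<delta> $ k)))) \<and>
        T_q'' N i * dEd'' $ i = Ed' $ i - Ed'' $ i + (X_q' N i - X_q'' N i) *
          (suscept N i i * Ed'' $ i -
           (\<Sum>k\<in>neighbors N i. suscept N i k *
              (Ed'' $ k * cos (\<delta> $ i - \<delta> $ k) - Eq'' $ k * sin (\<delta> $ i - \<delta> $ k)))))"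

definition multi_machine_trajectory ::
  "('n::finite, 'm::finite) network \<Rightarrow> real set \<Rightarrow> (real \<Rightarrow> real^'n) \<Rightarrow>
   (real \<Rightarrow> real^'n) \<Rightarrow> (real \<Rightarrow> real^'n) \<Rightarrow> (real \<Rightarrow> real^'n) \<Rightarrow> (real \<Rightarrow> real^'n) \<Rightarrow>
   (real \<Rightarrow> real^'n) \<Rightarrow> (real \<Rightarrow> real^'n) \<Rightarrow> bool" where
  "multi_machine_trajectory N I Pm \<omega> \<delta> Eq' Ed' Eq'' Ed'' \<longleftrightarrow>
     (\<forall>t\<in>I. \<exists>d\<omega> d\<delta> dEq' dEd' dEq'' dEd''.
        (\<omega> has_vector_derivative d\<omega>) (at t within I) \<and>
        (\<delta> has_vector_derivative d\<delta>) (at t within I) \<and>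
        (Eq' has_vector_derivative dEq') (at t within I) \<and>
        (Ed' has_vector_derivative dEd') (at t within I) \<and>
        (Eq'' has_vector_derivative dEq'') (at t within I) \<and>
        (Ed'' has_vector_derivative dEd'') (at t within I) \<and>
        multi_machine_equations N (Pm t) (\<omega> t) (\<delta> t) (Eq' t) (Ed' t) (Eq'' t) (Ed'' t)
          d\<omega> d\<delta> dEq' dEd' dEq'' dEd'')"


section \<open>State vector, Hamiltonian and structure matrices\<close>

text \<open>
  Coordinates of the state $(p, \eta, E_q', E_d', E_q'', E_d'')$, one constructor per
  block; the state space \<open>real^('n, 'm) coord\<close> has dimension $5n + m$.
\<close>

datatype ('n, 'm) coord =
    C_p 'n | C_\<eta> 'm | C_Eq' 'n | C_Ed' 'n | C_Eq'' 'n | C_Ed'' 'n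

instance coord :: (finite, finite) finite
proof
  have "(UNIV :: ('a, 'b) coord set) =
      range C_p \<union> range C_\<eta> \<union> range C_Eq' \<union> range C_Ed' \<union> range C_Eq'' \<union> range C_Ed''"
  proof (rule set_eqI)
    fix a :: "('a, 'b) coord"
    show "a \<in> UNIV \<longleftrightarrow>
      a \<in> range C_p \<union> range C_\<eta> \<union> range C_Eq' \<union> range C_Ed' \<union> range C_Eq'' \<union> range C_Ed''"
      by (cases a) auto
  qed
  then show "finite (UNIV :: ('a, 'b) coord set)"
    by (metis finite_Un finite_imageI finite_code)
qed

definition stack ::
  "real^'n \<Rightarrow> real^'m \<Rightarrow> real^'n \<Rightarrow> real^'n \<Rightarrow> real^'n \<Rightarrow> real^'n \<Rightarrow>
   real^(('n::finite), ('m::finite)) coord" where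
  "stack p \<eta> Eq' Ed' Eq'' Ed'' =
     (\<chi> a. case a of
         C_p i \<Rightarrow> p $ i
       | C_\<eta> l \<Rightarrow> \<eta> $ l
       | C_Eq' i \<Rightarrow> Eq' $ i
       | C_Ed' i \<Rightarrow> Ed' $ i
       | C_Eq'' i \<Rightarrow> Eq'' $ i
       | C_Ed'' i \<Rightarrow> Ed'' $ i)"

definition state_of ::
  "('n::finite, 'm::finite) network \<Rightarrow> real^'n \<Rightarrow> real^'n \<Rightarrow>
   real^'n \<Rightarrow> real^'n \<Rightarrow> real^'n \<Rightarrow> real^'n \<Rightarrow> real^('n, 'm) coord" where
  "state_of N \<omega> \<delta> Eq' Ed' Eq'' Ed'' =
     stack (\<chi> i. inertia N i * \<omega> $ i) (transpose (D_mat N) *v \<delta>) Eq' Ed' Eq'' Ed''"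

definition H_ed :: "('n::finite, 'm::finite) network \<Rightarrow> 'n \<Rightarrow> real^('n, 'm) coord \<Rightarrow> real" where
  "H_ed N i x = 1 / 2 *
     ((x $ C_Eq' i - E_f N i)\<^sup>2 / (X_d N i - X_d' N i) +
      (x $ C_Eq' i - x $ C_Eq'' i)\<^sup>2 / (X_d' N i - X_d'' N i))"

definition H_eq :: "('n::finite, 'm::finite) network \<Rightarrow> 'n \<Rightarrow> real^('n, 'm) coord \<Rightarrow> real" where
  "H_eq N i x = 1 / 2 *
     ((x $ C_Ed' i)\<^sup>2 / (X_q N i - X_q' N i) +
      (x $ C_Ed' i - x $ C_Ed'' i)\<^sup>2 / (X_q' N i - X_q'' N i))"

definition H_m :: "('n::finite, 'm::finite) network \<Rightarrow> 'n \<Rightarrow> real^('n, 'm) coord \<Rightarrow> real" where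
  "H_m N i x = 1 / 2 * inverse (inertia N i) * (x $ C_p i)\<^sup>2"

definition H_line :: "('n::finite, 'm::finite) network \<Rightarrow> 'm \<Rightarrow> real^('n, 'm) coord \<Rightarrow> real" where
  "H_line N l x =
     (let i = pos_end N l; k = neg_end N l in
       - (1 / 2) * suscept N i k *
         (2 * (x $ C_Ed'' i * x $ C_Eq'' k - x $ C_Ed'' k * x $ C_Eq'' i) * sin (x $ C_\<eta> l) -
          2 * (x $ C_Ed'' i * x $ C_Ed'' k + x $ C_Eq'' i * x $ C_Eq'' k) * cos (x $ C_\<eta> l) +
          (x $ C_Ed'' i)\<^sup>2 + (x $ C_Ed'' k)\<^sup>2 + (x $ C_Eq'' i)\<^sup>2 + (x $ C_Eq'' k)\<^sup>2))"

definition H_p :: "('n::finite, 'm::finite) network \<Rightarrow> real^('n, 'm) coord \<Rightarrow> real" where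
  "H_p N x = (\<Sum>i\<in>UNIV. H_ed N i x + H_eq N i x + H_m N i x) + (\<Sum>l\<in>UNIV. H_line N l x)"

definition diag :: "('n::finite \<Rightarrow> real) \<Rightarrow> real^'n^'n" where
  "diag v = (\<chi> i k. if i = k then v i else 0)"

definition F_mat ::
  "('n::finite, 'm::finite) network \<Rightarrow> real^('n, 'm) coord^('n, 'm) coord" where
  "F_mat N =
     (let Xd_hat  = diag (\<lambda>i. X_d N i - X_d' N i);
          Xd_hat' = diag (\<lambda>i. X_d' N i - X_d'' N i);
          Xq_hat  = diag (\<lambda>i. X_q N i - X_q' N i);
          Xq_hat' = diag (\<lambda>i. X_q' N i - X_q'' N i)
      in \<chi> a b. case (a, b) of
           (C_p i, C_\<eta> l) \<Rightarrow> - D_mat N $ i $ l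
         | (C_\<eta> l, C_p i) \<Rightarrow> transpose (D_mat N) $ l $ i
         | (C_Eq' i, C_Eq' k) \<Rightarrow> - (matrix_inv (diag (T_d' N)) ** Xd_hat) $ i $ k
         | (C_Eq' i, C_Eq'' k) \<Rightarrow> - (matrix_inv (diag (T_d' N)) ** Xd_hat) $ i $ k
         | (C_Ed' i, C_Ed' k) \<Rightarrow> - (matrix_inv (diag (T_q' N)) ** Xq_hat) $ i $ k
         | (C_Ed' i, C_Ed'' k) \<Rightarrow> - (matrix_inv (diag (T_q' N)) ** Xq_hat) $ i $ k
         | (C_Eq'' i, C_Eq'' k) \<Rightarrow> - (matrix_inv (diag (T_d'' N)) ** Xd_hat') $ i $ k
         | (C_Ed'' i, C_Ed'' k) \<Rightarrow> - (matrix_inv (diag (T_q'' N)) ** Xq_hat') $ i $ k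
         | _ \<Rightarrow> 0)"

definition g_mat :: "('n::finite, 'm::finite) network \<Rightarrow> real^'n^('n, 'm) coord" where
  "g_mat N = (\<chi> a k. case a of C_p i \<Rightarrow> mat 1 $ i $ k | _ \<Rightarrow> 0)"

definition J_mat ::
  "('n::finite, 'm::finite) network \<Rightarrow> real^('n, 'm) coord^('n, 'm) coord" where
  "J_mat N = (1 / 2) *\<^sub>R (F_mat N - transpose (F_mat N))"

definition R_mat ::
  "('n::finite, 'm::finite) network \<Rightarrow> real^('n, 'm) coord^('n, 'm) coord" where
  "R_mat N = (- 1 / 2) *\<^sub>R (F_mat N + transpose (F_mat N))"

end

theory Submission
  imports Defs
begin

text \<open>
  Everything rests on one pointwise identity, \<open>multi_machine_equations_iff\<close>: the machine
  equations at one instant say exactly that \<open>d\<delta> = \<omega>\<close> and that the linear image of the remaining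
  derivatives under \<open>state_of\<close> is \<open>F \<nabla>H\<^sub>p(x) + g (P\<^sub>m - P\<^sub>d)\<close>. Three observations give it.
  An edge energy depends only on the two machines at its ends, and swapping the ends while
  negating the angle leaves it unchanged, since \<open>B\<close> is symmetric. Hence a partial derivative of the
  total edge energy with respect to a subtransient voltage of machine \<open>i\<close> is a sum over the
  neighbours of \<open>i\<close>, whatever the orientation of the edges (\<open>sum_neighbors\<close>), and the same holds for
  \<open>D\<close> applied to the derivatives with respect to the angles, because swapping the ends of an
  edge flips the sign of both such a derivative and the entry of \<open>D\<close> at a given end.
  The term \<open>B\<^bsub>ii\<^esub> E\<^sub>i''\<close> of the model collects the quadratic part of the edge energies at \<open>i\<close>.
  Finally, the transient rows of \<open>F\<close> add the derivatives with respect to the transient and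
  the subtransient voltage; this cancels the coupling \<open>(E' - E'')\<^sup>2\<close> and leaves the relaxation
  and network terms of the model.

  Passing from instants to trajectories is then linear: \<open>state_of\<close> commutes with
  differentiation (\<open>state_of_has_vector_derivative\<close>). For the way back, the angle block of the
  vector field is \<open>D\<^sup>T \<omega>\<close>, which the given derivative of \<open>\<delta>\<close> already accounts for.

  For dissipativity, \<open>J\<close> contributes nothing to \<open>x \<bullet> F x\<close>, so \<open>x \<bullet> R x = - x \<bullet> F x\<close>. The incidence
  blocks cancel, and what is left splits, for each machine and each axis, into a form
  \<open>a u (u + v) + b v\<^sup>2\<close> with \<open>a\<close> and \<open>b\<close> ratios of a reactance difference to a time constant. The
  form is nonnegative when \<open>a \<le> 4 b\<close> (\<open>binary_form_nonneg\<close>), which follows from the assumption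
  on the parameters after division by the two time constants.
\<close>

section \<open>Coordinates of the state space\<close>

lemma sum_coord:
  fixes f :: "('n::finite, 'm::finite) coord \<Rightarrow> 'a::comm_monoid_add"
  shows "(\<Sum>a\<in>UNIV. f a) =
    (\<Sum>i\<in>UNIV. f (C_p i)) + (\<Sum>l\<in>UNIV. f (C_\<eta> l)) + (\<Sum>i\<in>UNIV. f (C_Eq' i)) +
    (\<Sum>i\<in>UNIV. f (C_Ed' i)) + (\<Sum>i\<in>UNIV. f (C_Eq'' i)) + (\<Sum>i\<in>UNIV. f (C_Ed'' i))"
proof -
  have U: "(UNIV :: ('n, 'm) coord set) =
      range C_p \<union> range C_\<eta> \<union> range C_Eq' \<union> range C_Ed' \<union> range C_Eq'' \<union> range C_Ed''"
  proof (rule set_eqI)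
    fix a :: "('n, 'm) coord"
    show "a \<in> UNIV \<longleftrightarrow>
      a \<in> range C_p \<union> range C_\<eta> \<union> range C_Eq' \<union> range C_Ed' \<union> range C_Eq'' \<union> range C_Ed''"
      by (cases a) auto
  qed
  have image: "sum f (range c) = (\<Sum>i\<in>UNIV. f (c i))"
    if "inj c" for c :: "'k::finite \<Rightarrow> ('n, 'm) coord"
    using sum.reindex[OF that] by simp
  show ?thesis
    unfolding U
    by (subst sum.union_disjoint | (auto; fail))+ (simp add: image inj_def)
qed

lemma vec_eq_coord_iff:
  fixes x y :: "'a^(('n::finite, 'm::finite) coord)"
  shows "x = y \<longleftrightarrow>
    (\<forall>l. x $ C_\<eta> l = y $ C_\<eta> l) \<and>
    (\<forall>i. x $ C_p i = y $ C_p i \<and> x $ C_Eq' i = y $ C_Eq' i \<and> x $ C_Ed' i = y $ C_Ed' i \<and>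
         x $ C_Eq'' i = y $ C_Eq'' i \<and> x $ C_Ed'' i = y $ C_Ed'' i)" (is "_ \<longleftrightarrow> ?R")
proof
  assume ?R
  show "x = y"
    unfolding vec_eq_iff
  proof
    fix a
    show "x $ a = y $ a"
      using \<open>?R\<close> by (cases a) auto
  qed
qed simp

lemma stack_nth [simp]:
  "stack p \<eta> Eq' Ed' Eq'' Ed'' $ C_p i = p $ i"
  "stack p \<eta> Eq' Ed' Eq'' Ed'' $ C_\<eta> l = \<eta> $ l"
  "stack p \<eta> Eq' Ed' Eq'' Ed'' $ C_Eq' i = Eq' $ i"
  "stack p \<eta> Eq' Ed' Eq'' Ed'' $ C_Ed' i = Ed' $ i"
  "stack p \<eta> Eq' Ed' Eq'' Ed'' $ C_Eq'' i = Eq'' $ i"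
  "stack p \<eta> Eq' Ed' Eq'' Ed'' $ C_Ed'' i = Ed'' $ i"
  by (simp_all add: stack_def)

section \<open>Parameters and sums over neighbours\<close>

lemma machine_network_pos:
  assumes "machine_network N"
  shows "0 < inertia N i"
    "0 < T_d' N i" "0 < T_q' N i" "0 < T_d'' N i" "0 < T_q'' N i"
    "0 < X_d N i - X_d' N i" "0 < X_q N i - X_q' N i"
    "0 < X_d' N i - X_d'' N i" "0 < X_q' N i - X_q'' N i"
  using assms by (auto simp: machine_network_def)

lemma pos_end_neq_neg_end:
  assumes "machine_network N"
  shows "pos_end N l \<noteq> neg_end N l"
  using assms by (simp add: machine_network_def)

text \<open>
  Sending an edge at \<open>i\<close> to its other end is a bijection onto the neighbours of \<open>i\<close>, because
  there are no parallel edges.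
\<close>

lemma sum_neighbors:
  fixes N :: "('n::finite, 'm::finite) network" and f :: "'n \<Rightarrow> 'a::comm_monoid_add"
  assumes "machine_network N"
  shows "(\<Sum>k\<in>neighbors N i. f k) =
    (\<Sum>l\<in>UNIV. if i = pos_end N l then f (neg_end N l)
               else if i = neg_end N l then f (pos_end N l) else 0)"
proof -
  define S where "S = {l. i = pos_end N l \<or> i = neg_end N l}"
  define other where "other l = (if i = pos_end N l then neg_end N l else pos_end N l)" for l
  have "inj (\<lambda>l. {pos_end N l, neg_end N l})"
    using assms by (simp add: machine_network_def)
  moreover have ends: "{pos_end N l, neg_end N l} = {i, other l}" if "l \<in> S" for l
    using that by (auto simp: S_def other_def)
  ultimately have "inj_on other S"
    by (auto simp: inj_on_def inj_def)
  moreover have "other ` S = neighbors N i"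
  proof
    show "other ` S \<subseteq> neighbors N i"
      using ends by (auto simp: neighbors_def adjacent_def)
    show "neighbors N i \<subseteq> other ` S"
    proof
      fix k assume "k \<in> neighbors N i"
      then obtain l where "{pos_end N l, neg_end N l} = {i, k}"
        by (auto simp: neighbors_def adjacent_def)
      then have "l \<in> S" "other l = k"
        by (auto simp: S_def other_def doubleton_eq_iff)
      then show "k \<in> other ` S" by blast
    qed
  qed
  ultimately have "(\<Sum>k\<in>neighbors N i. f k) = (\<Sum>l\<in>S. f (other l))"
    using sum.reindex[of other S f] by simp
  also have "\<dots> = (\<Sum>l\<in>UNIV. if l \<in> S then f (other l) else 0)"
    by (simp add: sum.If_cases)
  also have "\<dots> = (\<Sum>l\<in>UNIV. if i = pos_end N l then f (neg_end N l)
               else if i = neg_end N l then f (pos_end N l) else 0)"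
    by (rule sum.cong) (auto simp: S_def other_def)
  finally show ?thesis .
qed

lemma suscept_ends_commute:
  assumes "machine_network N"
  shows "suscept N (neg_end N l) (pos_end N l) = suscept N (pos_end N l) (neg_end N l)"
proof -
  have "adjacent N (neg_end N l) (pos_end N l)"
    by (auto simp: adjacent_def)
  then show ?thesis
    using assms by (auto simp: machine_network_def)
qed

section \<open>The gradient of the Hamiltonian\<close>

text \<open>
  The gradients are written as sums of axis vectors: the inner product with a direction \<open>h\<close>
  then expands into the directional derivative, and a component of a sum over all
  machines or edges reduces to the terms that touch it.
\<close>

definition machine_gradient ::
  "('n::finite, 'm::finite) network \<Rightarrow> 'n \<Rightarrow> real^('n, 'm) coord \<Rightarrow> real^('n, 'm) coord" where
  "machine_gradient N i x =
     axis (C_p i) (x $ C_p i / inertia N i) +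
     axis (C_Eq' i) ((x $ C_Eq' i - E_f N i) / (X_d N i - X_d' N i) +
                     (x $ C_Eq' i - x $ C_Eq'' i) / (X_d' N i - X_d'' N i)) +
     axis (C_Eq'' i) ((x $ C_Eq'' i - x $ C_Eq' i) / (X_d' N i - X_d'' N i)) +
     axis (C_Ed' i) (x $ C_Ed' i / (X_q N i - X_q' N i) +
                     (x $ C_Ed' i - x $ C_Ed'' i) / (X_q' N i - X_q'' N i)) +
     axis (C_Ed'' i) ((x $ C_Ed'' i - x $ C_Ed' i) / (X_q' N i - X_q'' N i))"

definition line_gradient ::
  "('n::finite, 'm::finite) network \<Rightarrow> 'm \<Rightarrow> real^('n, 'm) coord \<Rightarrow> real^('n, 'm) coord" where
  "line_gradient N l x =
     (let i = pos_end N l; k = neg_end N l; B = suscept N i k;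
          c = cos (x $ C_\<eta> l); s = sin (x $ C_\<eta> l)
      in axis (C_\<eta> l) (- B * ((x $ C_Ed'' i * x $ C_Eq'' k - x $ C_Ed'' k * x $ C_Eq'' i) * c +
                              (x $ C_Ed'' i * x $ C_Ed'' k + x $ C_Eq'' i * x $ C_Eq'' k) * s)) +
         axis (C_Eq'' i) (B * (x $ C_Ed'' k * s + x $ C_Eq'' k * c - x $ C_Eq'' i)) +
         axis (C_Eq'' k) (B * (- x $ C_Ed'' i * s + x $ C_Eq'' i * c - x $ C_Eq'' k)) +
         axis (C_Ed'' i) (B * (x $ C_Ed'' k * c - x $ C_Eq'' k * s - x $ C_Ed'' i)) +
         axis (C_Ed'' k) (B * (x $ C_Ed'' i * c + x $ C_Eq'' i * s - x $ C_Ed'' k)))"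

definition H_p_gradient ::
  "('n::finite, 'm::finite) network \<Rightarrow> real^('n, 'm) coord \<Rightarrow> real^('n, 'm) coord" where
  "H_p_gradient N x = (\<Sum>i\<in>UNIV. machine_gradient N i x) + (\<Sum>l\<in>UNIV. line_gradient N l x)"

lemma has_derivative_nth:
  "((\<lambda>x. x $ a) has_derivative (\<lambda>h. h $ a)) F"
  by (intro bounded_linear_imp_has_derivative bounded_linear_vec_nth)

text \<open>
  The bare rules that polynomials and sines of coordinates need. Once division is unfolded,
  quotients by parameters are products with constants, so no side conditions arise.
\<close>

lemmas has_derivative_coordinate_expr =
  has_derivative_const has_derivative_add has_derivative_diff has_derivative_minus
  has_derivative_mult has_derivative_power has_derivative_sin has_derivative_cos has_derivative_nth

lemma GDERIV_machine:
  "GDERIV (\<lambda>x. H_ed N i x + H_eq N i x + H_m N i x) x :> machine_gradient N i x"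
  unfolding gderiv_def H_ed_def H_eq_def H_m_def machine_gradient_def
    inner_add_right inner_axis inner_real_def divide_inverse
  by (rule has_derivative_eq_rhs, (rule has_derivative_coordinate_expr)+)
    (simp add: fun_eq_iff algebra_simps)

lemma GDERIV_line: "GDERIV (H_line N l) x :> line_gradient N l x"
  unfolding gderiv_def H_line_def line_gradient_def Let_def inner_add_right inner_axis inner_real_def
  by (rule has_derivative_eq_rhs, (rule has_derivative_coordinate_expr)+)
    (simp add: fun_eq_iff algebra_simps)

lemma GDERIV_sum:
  assumes "\<And>i. i \<in> A \<Longrightarrow> GDERIV (f i) x :> g i"
  shows "GDERIV (\<lambda>x. \<Sum>i\<in>A. f i x) x :> (\<Sum>i\<in>A. g i)"
  using assms unfolding gderiv_def inner_sum_right by (rule has_derivative_sum)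

lemma GDERIV_H_p: "GDERIV (H_p N) x :> H_p_gradient N x"
  using GDERIV_add[OF GDERIV_sum[OF GDERIV_machine] GDERIV_sum[OF GDERIV_line]]
  by (simp add: H_p_def[abs_def] H_p_gradient_def)

lemma gradient_eqI:
  assumes "GDERIV H x :> v"
  shows "gradient H x = v"
  unfolding gradient_def
proof (rule the_equality)
  fix w assume "GDERIV H x :> w"
  with assms have "(\<lambda>h. inner h w) = (\<lambda>h. inner h v)"
    unfolding gderiv_def by (rule has_derivative_unique[rotated])
  then show "w = v"
    by (metis inner_commute vector_eq_ldot)
qed (rule assms)

lemma axis_nth_if [simp]: "axis a c $ b = (if a = b then c else 0)"
  by (auto simp: axis_def)

lemma H_p_gradient_nth:
  fixes N :: "('n::finite, 'm::finite) network"
  shows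
  "H_p_gradient N x $ C_p i = x $ C_p i / inertia N i"
  "H_p_gradient N x $ C_\<eta> l = (let i = pos_end N l; k = neg_end N l in
     - suscept N i k * ((x $ C_Ed'' i * x $ C_Eq'' k - x $ C_Ed'' k * x $ C_Eq'' i) * cos (x $ C_\<eta> l) +
                        (x $ C_Ed'' i * x $ C_Ed'' k + x $ C_Eq'' i * x $ C_Eq'' k) * sin (x $ C_\<eta> l)))"
  "H_p_gradient N x $ C_Eq' i =
     (x $ C_Eq' i - E_f N i) / (X_d N i - X_d' N i) +
     (x $ C_Eq' i - x $ C_Eq'' i) / (X_d' N i - X_d'' N i)"
  "H_p_gradient N x $ C_Ed' i =
     x $ C_Ed' i / (X_q N i - X_q' N i) +
     (x $ C_Ed' i - x $ C_Ed'' i) / (X_q' N i - X_q'' N i)"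
  by (simp_all add: H_p_gradient_def machine_gradient_def line_gradient_def Let_def)

text \<open>
  A subtransient coordinate of machine \<open>i\<close> is touched by every edge at \<open>i\<close>, and by a loop it
  would be touched twice; a network has no loops, so the two cases below are exclusive.
\<close>

lemma H_p_gradient_subtransient_nth:
  fixes N :: "('n::finite, 'm::finite) network"
  assumes "machine_network N"
  shows
  "H_p_gradient N x $ C_Eq'' i = (x $ C_Eq'' i - x $ C_Eq' i) / (X_d' N i - X_d'' N i) +
     (\<Sum>l\<in>UNIV. let j = pos_end N l; k = neg_end N l; c = cos (x $ C_\<eta> l); s = sin (x $ C_\<eta> l) in
        if i = j then suscept N j k * (x $ C_Ed'' k * s + x $ C_Eq'' k * c - x $ C_Eq'' j)
        else if i = k then suscept N j k * (- x $ C_Ed'' j * s + x $ C_Eq'' j * c - x $ C_Eq'' k)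
        else 0)"
  "H_p_gradient N x $ C_Ed'' i = (x $ C_Ed'' i - x $ C_Ed' i) / (X_q' N i - X_q'' N i) +
     (\<Sum>l\<in>UNIV. let j = pos_end N l; k = neg_end N l; c = cos (x $ C_\<eta> l); s = sin (x $ C_\<eta> l) in
        if i = j then suscept N j k * (x $ C_Ed'' k * c - x $ C_Eq'' k * s - x $ C_Ed'' j)
        else if i = k then suscept N j k * (x $ C_Ed'' j * c + x $ C_Eq'' j * s - x $ C_Ed'' k)
        else 0)"
  using pos_end_neq_neg_end[OF assms, THEN not_sym]
  by (auto simp: H_p_gradient_def machine_gradient_def line_gradient_def Let_def intro!: sum.cong)

section \<open>The structure matrices\<close>

lemma matrix_inv_diag_mult_diag:
  assumes "\<And>i. v i \<noteq> 0"
  shows "matrix_inv (diag v) ** diag w = diag (\<lambda>i. w i / v i)"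
proof -
  have mult: "diag a ** diag b = diag (\<lambda>i. a i * b i)" for a b :: "'a \<Rightarrow> real"
    by (simp add: diag_def matrix_matrix_mult_def vec_eq_iff if_distrib [of "\<lambda>x. x * _"] sum.delta
        cong: if_cong)
  have "diag (\<lambda>i. 1 / v i) ** diag v = mat 1" "diag v ** diag (\<lambda>i. 1 / v i) = mat 1"
    using assms by (simp_all add: mult) (simp_all add: diag_def mat_def vec_eq_iff)
  then have "invertible (diag v)" and left: "diag (\<lambda>i. 1 / v i) ** diag v = mat 1"
    by (auto simp: invertible_def)
  then have "diag v ** matrix_inv (diag v) = mat 1"
    unfolding invertible_def matrix_inv_def using someI_ex[of "\<lambda>A'. diag v ** A' = mat 1 \<and> A' ** diag v = mat 1"]
    by blast
  then have "matrix_inv (diag v) = diag (\<lambda>i. 1 / v i)"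
    using left by (metis matrix_mul_assoc matrix_mul_lid matrix_mul_rid)
  then show ?thesis
    by (simp add: mult)
qed

lemma sum_diag_mult: "(\<Sum>k\<in>UNIV. diag c $ i $ k * w k) = c i * w i"
  by (simp add: diag_def if_distrib [of "\<lambda>x. x * _"] cong: if_cong)

lemma F_mat_mult_nth:
  fixes N :: "('n::finite, 'm::finite) network"
  assumes "machine_network N"
  shows
  "(F_mat N *v v) $ C_p i = - (\<Sum>l\<in>UNIV. D_mat N $ i $ l * v $ C_\<eta> l)"
  "(F_mat N *v v) $ C_\<eta> l = (\<Sum>i\<in>UNIV. D_mat N $ i $ l * v $ C_p i)"
  "(F_mat N *v v) $ C_Eq' i = - ((X_d N i - X_d' N i) / T_d' N i) * (v $ C_Eq' i + v $ C_Eq'' i)"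
  "(F_mat N *v v) $ C_Ed' i = - ((X_q N i - X_q' N i) / T_q' N i) * (v $ C_Ed' i + v $ C_Ed'' i)"
  "(F_mat N *v v) $ C_Eq'' i = - ((X_d' N i - X_d'' N i) / T_d'' N i) * v $ C_Eq'' i"
  "(F_mat N *v v) $ C_Ed'' i = - ((X_q' N i - X_q'' N i) / T_q'' N i) * v $ C_Ed'' i"
  using machine_network_pos[OF assms, THEN less_imp_neq, THEN not_sym]
  by (simp_all add: matrix_vector_mult_def F_mat_def Let_def sum_coord matrix_inv_diag_mult_diag
      sum_negf sum_diag_mult)
    (simp_all add: transpose_def algebra_simps add_divide_distrib diff_divide_distrib)

lemma g_mat_mult_nth:
  fixes N :: "('n::finite, 'm::finite) network"
  shows
  "(g_mat N *v u) $ C_p i = u $ i"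
  "(g_mat N *v u) $ C_\<eta> l = 0"
  "(g_mat N *v u) $ C_Eq' i = 0"
  "(g_mat N *v u) $ C_Ed' i = 0"
  "(g_mat N *v u) $ C_Eq'' i = 0"
  "(g_mat N *v u) $ C_Ed'' i = 0"
  by (simp_all add: matrix_vector_mult_def g_mat_def mat_def if_distrib [of "\<lambda>x. x * _"] cong: if_cong)

lemma F_mat_eq: "F_mat N = J_mat N - R_mat N"
  by (simp add: J_mat_def R_mat_def vec_eq_iff transpose_def field_simps)

lemma J_mat_skew: "J_mat N = - transpose (J_mat N)"
  by (simp add: J_mat_def vec_eq_iff transpose_def field_simps)

lemma R_mat_sym: "R_mat N = transpose (R_mat N)"
  by (simp add: R_mat_def vec_eq_iff transpose_def field_simps)

text \<open>The quadratic form of the skew-symmetric part vanishes.\<close>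

lemma inner_R_mat: "x \<bullet> (R_mat N *v x) = - (x \<bullet> (F_mat N *v x))"
proof -
  have "x \<bullet> (J_mat N *v x) = (transpose (J_mat N) *v x) \<bullet> x"
    by (simp add: dot_lmul_matrix)
  also have "transpose (J_mat N) *v x = - (J_mat N *v x)"
    by (subst (2) J_mat_skew) (simp add: matrix_vector_mult_def vec_eq_iff sum_negf)
  also have "\<dots> \<bullet> x = - (x \<bullet> (J_mat N *v x))"
    by (simp add: inner_commute)
  finally show ?thesis
    by (simp add: F_mat_eq matrix_vector_mult_diff_rdistrib inner_diff_right)
qed

text \<open>Completing the square in \<open>u\<close> leaves \<open>(b - a / 4) v\<^sup>2\<close>.\<close>

lemma binary_form_nonneg:
  fixes a b u v :: real
  assumes "0 \<le> a" "a \<le> 4 * b"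
  shows "0 \<le> a * u * (u + v) + b * v * v"
proof -
  have "a * u * (u + v) + b * v * v = a * (u + v / 2)\<^sup>2 + (b - a / 4) * v\<^sup>2"
    by (simp add: power2_eq_square field_simps)
  then show ?thesis
    using assms by simp
qed

lemma R_mat_psd:
  fixes N :: "('n::finite, 'm::finite) network"
  assumes net: "machine_network N"
    and d: "\<forall>i. 4 * (X_d' N i - X_d'' N i) * T_d' N i - (X_d N i - X_d' N i) * T_d'' N i > 0"
    and q: "\<forall>i. 4 * (X_q' N i - X_q'' N i) * T_q' N i - (X_q N i - X_q' N i) * T_q'' N i > 0"
  shows "0 \<le> x \<bullet> (R_mat N *v x)"
proof -
  define form where "form a b u v = a * u * (u + v) + b * v * v" for a b u v :: real
  define ad bd aq bq where
    "ad i = (X_d N i - X_d' N i) / T_d' N i" and "bd i = (X_d' N i - X_d'' N i) / T_d'' N i" and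
    "aq i = (X_q N i - X_q' N i) / T_q' N i" and "bq i = (X_q' N i - X_q'' N i) / T_q'' N i" for i
  \<comment> \<open>The blocks \<open>- D\<close> and \<open>D\<^sup>T\<close> contribute opposite bilinear terms.\<close>
  have skew: "(\<Sum>i\<in>UNIV. x $ C_p i * (\<Sum>l\<in>UNIV. D_mat N $ i $ l * x $ C_\<eta> l)) =
    (\<Sum>l\<in>UNIV. x $ C_\<eta> l * (\<Sum>i\<in>UNIV. D_mat N $ i $ l * x $ C_p i))"
    unfolding sum_distrib_left by (subst sum.swap) (simp add: ac_simps)
  have "x \<bullet> (R_mat N *v x) =
    (\<Sum>i\<in>UNIV. form (ad i) (bd i) (x $ C_Eq' i) (x $ C_Eq'' i) +
               form (aq i) (bq i) (x $ C_Ed' i) (x $ C_Ed'' i))"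
    unfolding inner_R_mat
    by (simp add: inner_vec_def sum_coord F_mat_mult_nth[OF net] skew sum_negf)
      (simp add: form_def ad_def bd_def aq_def bq_def sum.distrib algebra_simps)
  also have "\<dots> \<ge> 0"
  proof (intro sum_nonneg add_nonneg_nonneg)
    fix i
    note machine_network_pos[OF net, of i]
    moreover have "(X_d N i - X_d' N i) * T_d'' N i < 4 * (X_d' N i - X_d'' N i) * T_d' N i"
      "(X_q N i - X_q' N i) * T_q'' N i < 4 * (X_q' N i - X_q'' N i) * T_q' N i"
      using d q by (simp_all add: algebra_simps)
    ultimately have "0 \<le> ad i" "0 \<le> aq i" "ad i \<le> 4 * bd i" "aq i \<le> 4 * bq i"
      by (simp_all add: ad_def bd_def aq_def bq_def divide_simps)
    then show "0 \<le> form (ad i) (bd i) (x $ C_Eq' i) (x $ C_Eq'' i)"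
      "0 \<le> form (aq i) (bq i) (x $ C_Ed' i) (x $ C_Ed'' i)"
      unfolding form_def by (simp_all only: binary_form_nonneg)
  qed
  finally show ?thesis .
qed

section \<open>The equations of motion\<close>

text \<open>The angle differences are kept in the form \<open>D\<^sup>T \<delta>\<close> in which \<open>state_of\<close> states them.\<close>

declare transpose_matrix_vector [simp del]

lemma transpose_D_mat_mult_nth:
  fixes N :: "('n::finite, 'm::finite) network"
  assumes "machine_network N"
  shows "(transpose (D_mat N) *v \<delta>) $ l = \<delta> $ pos_end N l - \<delta> $ neg_end N l"
proof -
  have "(if i = pos_end N l then 1 else if i = neg_end N l then - 1 else 0) * \<delta> $ i =
     (if i = pos_end N l then \<delta> $ i else 0) - (if i = neg_end N l then \<delta> $ i else 0)" for i
    using pos_end_neq_neg_end[OF assms, of l] by simp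
  then show ?thesis
    by (simp add: matrix_vector_mult_def transpose_def D_mat_def sum_subtractf)
qed

lemma sum_D_mat_mult:
  "(\<Sum>l\<in>UNIV. D_mat N $ i $ l * w l) =
   (\<Sum>l\<in>UNIV. if i = pos_end N l then w l else if i = neg_end N l then - w l else 0)"
  by (rule sum.cong) (auto simp: D_mat_def)

text \<open>
  The angle argument of \<open>state_of\<close> on the left is \<open>\<omega>\<close>, the derivative of \<open>\<delta>\<close>: as \<open>state_of\<close> is
  linear, this is the time derivative of the state. Its angle block agrees with \<open>F \<nabla>H\<^sub>p\<close>
  identically, since \<open>\<partial>H\<^sub>p / \<partial>p = \<omega>\<close>.
\<close>

lemma multi_machine_equations_iff:
  fixes N :: "('n::finite, 'm::finite) network"
  assumes net: "machine_network N"
  shows "multi_machine_equations N Pm \<omega> \<delta> Eq' Ed' Eq'' Ed'' d\<omega> d\<delta> dEq' dEd' dEq'' dEd'' \<longleftrightarrow>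
    d\<delta> = \<omega> \<and>
    state_of N d\<omega> \<omega> dEq' dEd' dEq'' dEd'' =
      F_mat N *v gradient (H_p N) (state_of N \<omega> \<delta> Eq' Ed' Eq'' Ed'') + g_mat N *v (Pm - P_d N)"
proof -
  define x where "x = state_of N \<omega> \<delta> Eq' Ed' Eq'' Ed''"
  define G where "G = H_p_gradient N x"
  note pos = machine_network_pos[OF net]
  have nths: "x $ C_p i = inertia N i * \<omega> $ i" "x $ C_\<eta> l = \<delta> $ pos_end N l - \<delta> $ neg_end N l"
    "x $ C_Eq' i = Eq' $ i" "x $ C_Ed' i = Ed' $ i" "x $ C_Eq'' i = Eq'' $ i" "x $ C_Ed'' i = Ed'' $ i" for i l
    by (simp_all add: x_def state_of_def transpose_D_mat_mult_nth[OF net])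
  have self: "suscept N i i = (\<Sum>k\<in>neighbors N i. suscept N i k)" for i
    using net by (auto simp: machine_network_def)
  have swap: "sin (a - b) = - sin (b - a)" "cos (a - b) = cos (b - a)" for a b :: real
    by (simp_all add: sin_diff cos_diff)
  \<comment> \<open>The network terms of the model: the power flowing into machine \<open>i\<close>, and the two
    voltage terms that multiply the reactance differences.\<close>
  define P where "P i = (\<Sum>k\<in>neighbors N i. suscept N i k *
             ((Ed'' $ i * Ed'' $ k + Eq'' $ i * Eq'' $ k) * sin (\<delta> $ i - \<delta> $ k) +
              (Ed'' $ i * Eq'' $ k - Eq'' $ i * Ed'' $ k) * cos (\<delta> $ i - \<delta> $ k)))" for i
  define Q where "Q i = suscept N i i * Eq'' $ i -
           (\<Sum>k\<in>neighbors N i. suscept N i k *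
              (Ed'' $ k * sin (\<delta> $ i - \<delta> $ k) + Eq'' $ k * cos (\<delta> $ i - \<delta> $ k)))" for i
  define S where "S i = suscept N i i * Ed'' $ i -
           (\<Sum>k\<in>neighbors N i. suscept N i k *
              (Ed'' $ k * cos (\<delta> $ i - \<delta> $ k) - Eq'' $ k * sin (\<delta> $ i - \<delta> $ k)))" for i
  \<comment> \<open>The network terms as components of the gradient. At the negative end of an edge the model
    has \<open>\<delta>\<^sub>k - \<delta>\<^sub>j\<close> where the edge has \<open>\<delta>\<^sub>j - \<delta>\<^sub>k\<close>, which \<open>swap\<close> reverses.\<close>
  have GP: "(\<Sum>l\<in>UNIV. D_mat N $ i $ l * G $ C_\<eta> l) = - P i" for i
    unfolding P_def sum_neighbors[OF net] sum_D_mat_mult sum_negf[symmetric] G_def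
    by (rule sum.cong[OF refl])
      (simp add: H_p_gradient_nth nths Let_def suscept_ends_commute[OF net]
        swap[of "\<delta> $ neg_end N _" "\<delta> $ pos_end N _"] algebra_simps)
  \<comment> \<open>Expanding \<open>B\<^bsub>ii\<^esub>\<close> makes each voltage term a single sum over the neighbours.\<close>
  have Q_eq: "- Q i = (\<Sum>k\<in>neighbors N i. suscept N i k *
      (Ed'' $ k * sin (\<delta> $ i - \<delta> $ k) + Eq'' $ k * cos (\<delta> $ i - \<delta> $ k) - Eq'' $ i))" for i
    unfolding Q_def self by (simp add: sum_distrib_right sum_subtractf right_diff_distrib)
  have GQ: "G $ C_Eq'' i = (Eq'' $ i - Eq' $ i) / (X_d' N i - X_d'' N i) - Q i" for i
    unfolding G_def H_p_gradient_subtransient_nth[OF net] nths diff_conv_add_uminus[of _ "Q i"] Q_eq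
      sum_neighbors[OF net]
    by (intro arg_cong2[where f="(+)"] refl sum.cong)
      (simp add: Let_def suscept_ends_commute[OF net]
        swap[of "\<delta> $ neg_end N _" "\<delta> $ pos_end N _"] algebra_simps)
  have S_eq: "- S i = (\<Sum>k\<in>neighbors N i. suscept N i k *
      (Ed'' $ k * cos (\<delta> $ i - \<delta> $ k) - Eq'' $ k * sin (\<delta> $ i - \<delta> $ k) - Ed'' $ i))" for i
    unfolding S_def self by (simp add: sum_distrib_right sum_subtractf right_diff_distrib)
  have GS: "G $ C_Ed'' i = (Ed'' $ i - Ed' $ i) / (X_q' N i - X_q'' N i) - S i" for i
    unfolding G_def H_p_gradient_subtransient_nth[OF net] nths diff_conv_add_uminus[of _ "S i"] S_eq
      sum_neighbors[OF net]
    by (intro arg_cong2[where f="(+)"] refl sum.cong)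
      (simp add: Let_def suscept_ends_commute[OF net]
        swap[of "\<delta> $ neg_end N _" "\<delta> $ pos_end N _"] algebra_simps)
  have Gp: "G $ C_p i = \<omega> $ i" for i
    using pos(1)[of i] by (simp add: G_def H_p_gradient_nth nths)
  have GEq': "G $ C_Eq' i = (Eq' $ i - E_f N i) / (X_d N i - X_d' N i) +
     (Eq' $ i - Eq'' $ i) / (X_d' N i - X_d'' N i)" for i
    by (simp add: G_def H_p_gradient_nth nths)
  have GEd': "G $ C_Ed' i = Ed' $ i / (X_q N i - X_q' N i) +
     (Ed' $ i - Ed'' $ i) / (X_q' N i - X_q'' N i)" for i
    by (simp add: G_def H_p_gradient_nth nths)
  \<comment> \<open>The shape of all four voltage equations: relaxation with time constant \<open>\<tau>\<close>.\<close>
  have relax: "\<tau> * d = c \<longleftrightarrow> d = - (y / \<tau>) * w" if "0 < \<tau>" "c = - y * w" for \<tau> d c y w :: real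
    using that by (auto simp: field_simps)
  have "multi_machine_equations N Pm \<omega> \<delta> Eq' Ed' Eq'' Ed'' d\<omega> d\<delta> dEq' dEd' dEq'' dEd'' \<longleftrightarrow>
    d\<delta> = \<omega> \<and>
    (\<forall>i. inertia N i * d\<omega> $ i = Pm $ i - P_d N $ i + P i \<and>
     T_d' N i * dEq' $ i = E_f N i - Eq' $ i + (X_d N i - X_d' N i) * Q i \<and>
     T_q' N i * dEd' $ i = - Ed' $ i + (X_q N i - X_q' N i) * S i \<and>
     T_d'' N i * dEq'' $ i = Eq' $ i - Eq'' $ i + (X_d' N i - X_d'' N i) * Q i \<and>
     T_q'' N i * dEd'' $ i = Ed' $ i - Ed'' $ i + (X_q' N i - X_q'' N i) * S i)"
    unfolding multi_machine_equations_def P_def[symmetric] Q_def[symmetric] S_def[symmetric]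
    by (auto simp: vec_eq_iff)
  also have "\<dots> \<longleftrightarrow> d\<delta> = \<omega> \<and>
    (\<forall>i. inertia N i * d\<omega> $ i = Pm $ i - P_d N $ i + P i \<and>
     dEq' $ i = - ((X_d N i - X_d' N i) / T_d' N i) * (G $ C_Eq' i + G $ C_Eq'' i) \<and>
     dEd' $ i = - ((X_q N i - X_q' N i) / T_q' N i) * (G $ C_Ed' i + G $ C_Ed'' i) \<and>
     dEq'' $ i = - ((X_d' N i - X_d'' N i) / T_d'' N i) * G $ C_Eq'' i \<and>
     dEd'' $ i = - ((X_q' N i - X_q'' N i) / T_q'' N i) * G $ C_Ed'' i)"
  proof (intro arg_cong2[where f="(\<and>)"] refl arg_cong[where f=All] ext relax pos)
    fix i
    show "E_f N i - Eq' $ i + (X_d N i - X_d' N i) * Q i =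
      - (X_d N i - X_d' N i) * (G $ C_Eq' i + G $ C_Eq'' i)"
      using pos(6,8)[of i] unfolding GEq' GQ by (simp add: divide_simps) (simp add: algebra_simps)
    show "- Ed' $ i + (X_q N i - X_q' N i) * S i =
      - (X_q N i - X_q' N i) * (G $ C_Ed' i + G $ C_Ed'' i)"
      using pos(7,9)[of i] unfolding GEd' GS by (simp add: divide_simps) (simp add: algebra_simps)
    show "Eq' $ i - Eq'' $ i + (X_d' N i - X_d'' N i) * Q i = - (X_d' N i - X_d'' N i) * G $ C_Eq'' i"
      using pos(8)[of i] unfolding GQ by (simp add: divide_simps) (simp add: algebra_simps)
    show "Ed' $ i - Ed'' $ i + (X_q' N i - X_q'' N i) * S i = - (X_q' N i - X_q'' N i) * G $ C_Ed'' i"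
      using pos(9)[of i] unfolding GS by (simp add: divide_simps) (simp add: algebra_simps)
  qed
  also have "\<dots> \<longleftrightarrow> d\<delta> = \<omega> \<and> state_of N d\<omega> \<omega> dEq' dEd' dEq'' dEd'' =
      F_mat N *v G + g_mat N *v (Pm - P_d N)"
    unfolding vec_eq_coord_iff[of "state_of N d\<omega> \<omega> dEq' dEd' dEq'' dEd''"]
    by (simp add: state_of_def F_mat_mult_nth[OF net] g_mat_mult_nth GP Gp)
      (auto simp: matrix_vector_mult_def transpose_def algebra_simps)
  finally show ?thesis
    unfolding gradient_eqI[OF GDERIV_H_p] G_def x_def .
qed

section \<open>Trajectories\<close>

lemma has_vector_derivative_vec_iff:
  fixes f :: "real \<Rightarrow> real^'k::finite"
  shows "(f has_vector_derivative D) (at t within I) \<longleftrightarrow>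
    (\<forall>a. ((\<lambda>t. f t $ a) has_vector_derivative D $ a) (at t within I))"
  unfolding has_vector_derivative_def
  by (subst has_derivative_componentwise_within) (simp add: Basis_vec_def inner_axis)

text \<open>
  The inertias are nonzero, so the momenta determine the frequencies; the angles enter only
  through \<open>D\<^sup>T \<delta>\<close>, from which \<open>\<delta>\<close> cannot be recovered, hence the derivative of \<open>\<delta>\<close> is assumed.
\<close>

lemma state_of_has_vector_derivative:
  fixes N :: "('n::finite, 'm::finite) network"
  assumes "machine_network N" and \<delta>: "(\<delta> has_vector_derivative d\<delta>) (at t within I)"
  shows "((\<lambda>t. state_of N (\<omega> t) (\<delta> t) (Eq' t) (Ed' t) (Eq'' t) (Ed'' t))
       has_vector_derivative state_of N d\<omega> d\<delta> dEq' dEd' dEq'' dEd'') (at t within I) \<longleftrightarrow>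
    (\<omega> has_vector_derivative d\<omega>) (at t within I) \<and>
    (Eq' has_vector_derivative dEq') (at t within I) \<and>
    (Ed' has_vector_derivative dEd') (at t within I) \<and>
    (Eq'' has_vector_derivative dEq'') (at t within I) \<and>
    (Ed'' has_vector_derivative dEd'') (at t within I)"
proof -
  have M: "inertia N i \<noteq> 0" for i
    using machine_network_pos(1)[OF assms(1), of i] by simp
  have p: "((\<lambda>t. inertia N i * \<omega> t $ i) has_vector_derivative inertia N i * d\<omega> $ i) (at t within I) \<longleftrightarrow>
     ((\<lambda>t. \<omega> t $ i) has_vector_derivative d\<omega> $ i) (at t within I)" (is "?L \<longleftrightarrow> ?R") for i
  proof
    assume ?L
    from has_vector_derivative_mult_right[OF this, of "1 / inertia N i"] show ?R
      using M[of i] by simp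
  qed (rule has_vector_derivative_mult_right)
  have \<eta>: "((\<lambda>t. (transpose (D_mat N) *v \<delta> t) $ l) has_vector_derivative (transpose (D_mat N) *v d\<delta>) $ l)
    (at t within I)" for l
    using bounded_linear.has_vector_derivative[OF matrix_vector_mul_bounded_linear \<delta>]
    unfolding has_vector_derivative_vec_iff by blast
  have all: "(\<forall>a. Q a) \<longleftrightarrow> (\<forall>i. Q (C_p i)) \<and> (\<forall>l. Q (C_\<eta> l)) \<and> (\<forall>i. Q (C_Eq' i)) \<and> (\<forall>i. Q (C_Ed' i)) \<and>
     (\<forall>i. Q (C_Eq'' i)) \<and> (\<forall>i. Q (C_Ed'' i))" for Q :: "('n, 'm) coord \<Rightarrow> bool"
    by (metis coord.exhaust)
  show ?thesis
    unfolding has_vector_derivative_vec_iff all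
    by (simp add: state_of_def p \<eta>)
qed

theorem proposition1:
  fixes N :: "('n::finite, 'm::finite) network"
  assumes "machine_network N"
    and "\<forall>i. 4 * (X_d' N i - X_d'' N i) * T_d' N i - (X_d N i - X_d' N i) * T_d'' N i > 0"
    and "\<forall>i. 4 * (X_q' N i - X_q'' N i) * T_q' N i - (X_q N i - X_q' N i) * T_q'' N i > 0"
  shows "F_mat N = J_mat N - R_mat N \<and>
    port_hamiltonian (J_mat N) (R_mat N) (H_p N) \<and>
    (\<forall>(I :: real set) (Pm :: real \<Rightarrow> real^'n) (\<omega> :: real \<Rightarrow> real^'n) (\<delta> :: real \<Rightarrow> real^'n)
       (Eq' :: real \<Rightarrow> real^'n) (Ed' :: real \<Rightarrow> real^'n)
       (Eq'' :: real \<Rightarrow> real^'n) (Ed'' :: real \<Rightarrow> real^'n). is_interval I \<longrightarrow>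
      (multi_machine_trajectory N I Pm \<omega> \<delta> Eq' Ed' Eq'' Ed'' \<longleftrightarrow>
        (\<forall>t\<in>I. (\<delta> has_vector_derivative \<omega> t) (at t within I)) \<and>
        (\<exists>y. system_trajectory (F_mat N) (H_p N) (g_mat N) I
           (\<lambda>t. Pm t - P_d N)
           (\<lambda>t. state_of N (\<omega> t) (\<delta> t) (Eq' t) (Ed' t) (Eq'' t) (Ed'' t))
           y)))"
proof (intro conjI allI impI)
  show "F_mat N = J_mat N - R_mat N"
    by (rule F_mat_eq)
  have "H_p N differentiable (at x)" for x
    using GDERIV_H_p by (auto simp: gderiv_def differentiable_def)
  then show "port_hamiltonian (J_mat N) (R_mat N) (H_p N)"
    unfolding port_hamiltonian_def
    using J_mat_skew R_mat_sym R_mat_psd[OF assms] by blast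
next
  fix I :: "real set" and Pm \<omega> \<delta> Eq' Ed' Eq'' Ed'' :: "real \<Rightarrow> real^'n"
  define x where "x t = state_of N (\<omega> t) (\<delta> t) (Eq' t) (Ed' t) (Eq'' t) (Ed'' t)" for t
  define f where "f t = F_mat N *v gradient (H_p N) (x t) + g_mat N *v (Pm t - P_d N)" for t
  have pointwise: "(\<exists>d\<omega> d\<delta> dEq' dEd' dEq'' dEd''.
        (\<omega> has_vector_derivative d\<omega>) (at t within I) \<and>
        (\<delta> has_vector_derivative d\<delta>) (at t within I) \<and>
        (Eq' has_vector_derivative dEq') (at t within I) \<and>
        (Ed' has_vector_derivative dEd') (at t within I) \<and>
        (Eq'' has_vector_derivative dEq'') (at t within I) \<and>
        (Ed'' has_vector_derivative dEd'') (at t within I) \<and>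
        multi_machine_equations N (Pm t) (\<omega> t) (\<delta> t) (Eq' t) (Ed' t) (Eq'' t) (Ed'' t)
          d\<omega> d\<delta> dEq' dEd' dEq'' dEd'') \<longleftrightarrow>
     (\<delta> has_vector_derivative \<omega> t) (at t within I) \<and> (x has_vector_derivative f t) (at t within I)"
    (is "?L \<longleftrightarrow> ?R") for t
  proof
    assume ?L
    then show ?R
      using state_of_has_vector_derivative[OF assms(1)]
      unfolding multi_machine_equations_iff[OF assms(1)] x_def[abs_def, symmetric] f_def
      by (metis (no_types, lifting) x_def ext)
  next
    assume R: ?R
    \<comment> \<open>The derivatives are read off the vector field: on a degenerate interval derivatives are
      not unique, so those of the components must be chosen to match it.\<close>
    define d\<omega> dEq' dEd' dEq'' dEd'' where "d\<omega> = (\<chi> i. f t $ C_p i / inertia N i)"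
      and "dEq' = (\<chi> i. f t $ C_Eq' i)" and "dEd' = (\<chi> i. f t $ C_Ed' i)"
      and "dEq'' = (\<chi> i. f t $ C_Eq'' i)" and "dEd'' = (\<chi> i. f t $ C_Ed'' i)"
    have M: "inertia N i \<noteq> 0" for i
      using machine_network_pos(1)[OF assms(1), of i] by simp
    have "f t $ C_\<eta> l = (transpose (D_mat N) *v \<omega> t) $ l" for l
      by (simp add: f_def x_def F_mat_mult_nth[OF assms(1)] g_mat_mult_nth
          gradient_eqI[OF GDERIV_H_p] H_p_gradient_nth
          state_of_def M) (simp add: matrix_vector_mult_def transpose_def)
    then have f: "state_of N d\<omega> (\<omega> t) dEq' dEd' dEq'' dEd'' = f t"
      unfolding vec_eq_coord_iff
      by (simp add: state_of_def M d\<omega>_def dEq'_def dEd'_def dEq''_def dEd''_def)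
    have "multi_machine_equations N (Pm t) (\<omega> t) (\<delta> t) (Eq' t) (Ed' t) (Eq'' t) (Ed'' t)
          d\<omega> (\<omega> t) dEq' dEd' dEq'' dEd''"
      unfolding multi_machine_equations_iff[OF assms(1)] using f by (simp add: f_def x_def)
    moreover have "(x has_vector_derivative state_of N d\<omega> (\<omega> t) dEq' dEd' dEq'' dEd'') (at t within I)"
      using R f by simp
    ultimately show ?L
      using R unfolding x_def[abs_def]
      by (subst (asm) state_of_has_vector_derivative[OF assms(1)]) blast+
  qed
  show "multi_machine_trajectory N I Pm \<omega> \<delta> Eq' Ed' Eq'' Ed'' \<longleftrightarrow>
        (\<forall>t\<in>I. (\<delta> has_vector_derivative \<omega> t) (at t within I)) \<and>
        (\<exists>y. system_trajectory (F_mat N) (H_p N) (g_mat N) I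
           (\<lambda>t. Pm t - P_d N)
           (\<lambda>t. state_of N (\<omega> t) (\<delta> t) (Eq' t) (Ed' t) (Eq'' t) (Ed'' t))
           y)"
    unfolding multi_machine_trajectory_def system_trajectory_def pointwise
      x_def[symmetric] f_def[symmetric]
    by (auto intro!: exI[of _ "\<lambda>t. transpose (g_mat N) *v gradient (H_p N) (x t)"])
qed

end
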